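(* Let $d \geq 1$ be an integer and let $Q \subset \mathbb{R}^d$ be a subset whose convex hull contains the Euclidean unit ball $\mathbf{B}^d$. Then there exist at most $2d$ points of $Q$ whose convex hull $Q'$ satisfies \[ \frac{1}{6d^2}\, \mathbf{B}^d \subset Q'. \]
   Context: $\mathbf{B}^d = \{x \in \mathbb{R}^d : |x| \leq 1\}$ denotes the standard closed Euclidean unit ball centered at the origin of $\mathbb{R}^d$, and for $r>0$, $r\mathbf{B}^d = \{r x : x \in \mathbf{B}^d\}$. The set $Q$ is arbitrary (not assumed convex, closed, bounded, or finite). *)

theory Defs
  imports "HOL-Analysis.Analysis"
begin

end

theory Submission
  imports Defs
begin

text \<open>
  The proof works with the polar body \<open>K = {x. \<forall>q\<in>Q. q \<bullet> x \<le> 1}\<close>. For finite \<open>Q\<close>,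
  a ball of radius \<open>r\<close> lies in \<open>convex hull G\<close> exactly when the half-spaces
  \<open>q \<bullet> x \<le> 1\<close> with \<open>q \<in> G\<close> intersect in a subset of the ball of radius \<open>1 / r\<close>
  (\<open>bipolar_finite\<close> gives the direction that is needed). So one has to pick \<open>2 d\<close> of the
  half-spaces that cut out \<open>K\<close>, such that their intersection is not much larger than \<open>K\<close>.

  The gain of this point of view is that the origin may be moved inside \<open>K\<close>. A vector \<open>q\<close>
  is then replaced by \<open>p = q / (1 - q \<bullet> c)\<close>, where \<open>c\<close> is the new centre. By choosing
  \<open>c\<close> as the centroid of a largest simplex in \<open>K\<close>, one gets \<open>- (K - c) \<subseteq> d (K - c)\<close>
  (\<open>convex_low_asymmetry_centre\<close>), and dually \<open>- p / d\<close> lies in the hull of the \<open>p\<close>'s.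

  Now take those \<open>d\<close> vectors \<open>v\<^sub>i\<close> among the \<open>p\<close>'s whose determinant is largest in
  absolute value. Every \<open>p\<close> is a combination of the \<open>v\<^sub>i\<close> with coefficients in \<open>[-1, 1]\<close>
  (\<open>Auerbach_basis\<close>). The \<open>v\<^sub>i\<close> alone bound a point \<open>z\<close> from one side only. For the
  other side, note that \<open>w = - (\<Sum>i. v\<^sub>i) / d\<^sup>2\<close> is in the hull of the \<open>p\<close>'s, hence is a
  subconvex combination of at most \<open>d\<close> of them (\<open>caratheodory_subconvex\<close>). If
  \<open>p \<bullet> z \<le> 1\<close> holds for all of these \<open>2 d\<close> vectors, then \<open>v\<^sub>i \<bullet> z \<le> 1\<close> and
  \<open>(\<Sum>i. v\<^sub>i \<bullet> z) \<ge> - d\<^sup>2\<close>, so that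
  \<open>(\<Sum>i. \<bar>v\<^sub>i \<bullet> z\<bar>) \<le> (\<Sum>i. 2 - v\<^sub>i \<bullet> z) \<le> d\<^sup>2 + 2 d\<close>
  (\<open>few_points_control_polar\<close>). Thus the chosen half-spaces intersect in a subset of
  \<open>c + M (K - c)\<close> with \<open>M = d\<^sup>2 + 2 d\<close>.

  An arbitrary \<open>Q\<close> is reduced to a finite one at the price of shrinking the ball to radius
  \<open>5/6\<close>. Then \<open>K\<close> is within the ball of radius \<open>6/5\<close> and the intersection within
  the ball of radius \<open>(2 M - 1) (6/5) \<le> 6 d\<^sup>2\<close>.
\<close>

section \<open>Bases of largest determinant\<close>

text \<open>
  A tuple in \<open>S\<close> that maximizes the absolute value of the determinant works: by Cramer's rule
  the \<open>i\<close>-th coefficient of \<open>p\<close> is the factor by which the determinant changes when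
  \<open>v i\<close> is replaced by \<open>p\<close>.
\<close>

lemma Auerbach_basis:
  fixes S :: "(real ^ 'n) set"
  assumes "compact S" and "span S = UNIV"
  obtains v :: "'n \<Rightarrow> real ^ 'n"
  where "\<forall>i. v i \<in> S"
    and "\<forall>p\<in>S. \<exists>\<alpha>. p = (\<Sum>i\<in>UNIV. \<alpha> i *\<^sub>R v i) \<and> (\<forall>i. \<bar>\<alpha> i\<bar> \<le> 1)"
proof -
  define X where "X = {A :: real ^ 'n ^ 'n. \<forall>i. A $ i \<in> S}"
  obtain B where B: "B \<subseteq> S" "independent B" "S \<subseteq> span B"
    using basis_exists by metis
  have spB: "span B = UNIV"
    using B(3) assms(2) by (metis span_minimal subspace_span top.extremum_uniqueI)
  have "card B = CARD('n)"
    using B(2) spB by (metis DIM_cart DIM_real dim_UNIV dim_eq_card mult.right_neutral span_UNIV dim_span)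
  then obtain b :: "'n \<Rightarrow> real ^ 'n" where b: "bij_betw b UNIV B"
    using B(2) by (metis finite_same_card_bij finite_class.finite_UNIV independent_imp_finite)
  define A0 :: "real ^ 'n ^ 'n" where "A0 = (\<chi> i. b i)"
  have "rows A0 = B"
    using b by (auto simp: rows_def row_def A0_def bij_betw_def)
  then have "det A0 \<noteq> 0"
    using spB by (metis invertible_det_nz invertible_left_inverse matrix_left_invertible_span_rows)
  have "A0 \<in> X"
    using b B(1) by (auto simp: X_def A0_def bij_betw_def)
  have "compact X"
  proof -
    have "closed X"
      unfolding X_def using compact_imp_closed[OF assms(1)] by (intro closed_vector_box) auto
    moreover obtain C where C: "\<And>x. x \<in> S \<Longrightarrow> norm x \<le> C"
      using compact_imp_bounded[OF assms(1)] by (auto simp: bounded_iff)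
    have "norm A \<le> (\<Sum>i\<in>(UNIV::'n set). C)" if "A \<in> X" for A
    proof -
      have "norm A \<le> (\<Sum>i\<in>UNIV. norm (A $ i))"
        unfolding norm_vec_def by (rule L2_set_le_sum) auto
      also have "\<dots> \<le> (\<Sum>i\<in>(UNIV::'n set). C)"
        using that C by (intro sum_mono) (auto simp: X_def)
      finally show ?thesis .
    qed
    then have "bounded X" unfolding bounded_iff by blast
    ultimately show ?thesis by (simp add: compact_eq_bounded_closed)
  qed
  moreover have "continuous_on X (\<lambda>A. \<bar>det A\<bar>)"
    unfolding det_def by (intro continuous_intros)
  ultimately obtain A where A: "A \<in> X" and max: "\<And>A'. A' \<in> X \<Longrightarrow> \<bar>det A'\<bar> \<le> \<bar>det A\<bar>"
    using continuous_attains_sup[of X "\<lambda>A. \<bar>det A\<bar>"] \<open>A0 \<in> X\<close> by blast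
  have pos: "\<bar>det A\<bar> > 0" using max[OF \<open>A0 \<in> X\<close>] \<open>det A0 \<noteq> 0\<close> by linarith
  show thesis
  proof (rule that[of "\<lambda>i. A $ i"])
    show "\<forall>i. A $ i \<in> S" using A by (simp add: X_def)
  next
    show "\<forall>p\<in>S. \<exists>\<alpha>. p = (\<Sum>i\<in>UNIV. \<alpha> i *\<^sub>R A $ i) \<and> (\<forall>i. \<bar>\<alpha> i\<bar> \<le> 1)"
    proof
      fix p assume p: "p \<in> S"
      have "invertible (transpose A)"
        using pos by (simp add: invertible_det_nz)
      then obtain x where x: "transpose A *v x = p"
        by (metis invertible_def matrix_vector_mul_assoc matrix_vector_mul_lid)
      have p_eq: "(\<Sum>i\<in>UNIV. x $ i *s row i A) = p"
        using x by (simp add: matrix_mult_sum)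
      have "\<bar>x $ k\<bar> \<le> 1" for k
      proof -
        let ?A' = "(\<chi> i. if i = k then p else row i A) :: real ^ 'n ^ 'n"
        have "?A' \<in> X"
          using A p by (auto simp: X_def row_def)
        moreover have "det ?A' = x $ k * det A"
          using cramer_lemma_transpose[of k x A] unfolding p_eq .
        ultimately have "\<bar>x $ k\<bar> * \<bar>det A\<bar> \<le> 1 * \<bar>det A\<bar>"
          using max[of ?A'] by (simp add: abs_mult)
        then show ?thesis using pos by (simp only: mult_le_cancel_right_pos)
      qed
      moreover have "p = (\<Sum>i\<in>UNIV. x $ i *\<^sub>R A $ i)"
        using p_eq by (simp add: row_def scalar_mult_eq_scaleR)
      ultimately show "\<exists>\<alpha>. p = (\<Sum>i\<in>UNIV. \<alpha> i *\<^sub>R A $ i) \<and> (\<forall>i. \<bar>\<alpha> i\<bar> \<le> 1)"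
        by blast
    qed
  qed
qed

section \<open>A centre of low asymmetry\<close>

text \<open>
  The centre is the centroid of a simplex of largest volume in \<open>K\<close>. Maximality says that all
  barycentric coordinates \<open>\<alpha>\<^sub>i\<close> of a point \<open>k\<close> of \<open>K\<close> are at most \<open>1\<close>. The point
  \<open>c - (k - c) / d\<close> has barycentric coordinates \<open>(1 - \<alpha>\<^sub>i) / d \<ge> 0\<close>, and so it is in the
  simplex. Embedding \<open>K\<close> at height \<open>1\<close> in one dimension more turns barycentric into
  linear coordinates, so that the simplex comes from \<open>Auerbach_basis\<close>.
\<close>

lemma convex_low_asymmetry_centre:
  fixes K :: "(real ^ 'd) set"
  assumes "compact K" "convex K" "e > 0" "cball 0 e \<subseteq> K"
  obtains c where "c \<in> K" and "\<And>k. k \<in> K \<Longrightarrow> c - (1 / real CARD('d)) *\<^sub>R (k - c) \<in> K"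
proof -
  let ?d = "real CARD('d)"
  define lift :: "real ^ 'd \<Rightarrow> real ^ ('d option)"
    where "lift x = (\<chi> i. case i of None \<Rightarrow> 1 | Some j \<Rightarrow> x $ j)" for x
  define drop :: "real ^ ('d option) \<Rightarrow> real ^ 'd" where "drop y = (\<chi> j. y $ Some j)" for y
  have drop_lift [simp]: "drop (lift x) = x" for x by (simp add: drop_def lift_def vec_eq_iff)
  have lin_drop: "linear drop" by (rule linearI) (simp_all add: drop_def vec_eq_iff)
  have "continuous_on K lift"
    unfolding lift_def
  proof (rule continuous_on_vec_lambda)
    show "continuous_on K (\<lambda>x. case i of None \<Rightarrow> 1 | Some j \<Rightarrow> x $ j)" for i
      by (cases i) (simp_all add: continuous_on_component)
  qed
  then have "compact (lift ` K)" using assms(1) by (rule compact_continuous_image)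
  moreover have "span (lift ` K) = UNIV"
  proof -
    have l: "lift x \<in> span (lift ` K)" if "x \<in> K" for x using that by (blast intro: span_base)
    have 0: "0 \<in> K" using assms(3,4) by auto
    have "axis i 1 \<in> span (lift ` K)" for i
    proof (cases i)
      case None
      have "axis i 1 = lift 0"
        by (auto simp: lift_def axis_def vec_eq_iff None split: option.split)
      then show ?thesis using l[OF 0] by simp
    next
      case (Some j)
      have "e *\<^sub>R axis j 1 \<in> K" using assms(3,4) by (auto simp: norm_axis_1)
      moreover have "axis i 1 = (1 / e) *\<^sub>R (lift (e *\<^sub>R axis j 1) - lift 0)"
        using assms(3) by (auto simp: lift_def axis_def vec_eq_iff Some split: option.split)
      ultimately show ?thesis using l 0 by (metis span_diff span_scale)
    qed
    then have "Basis \<subseteq> span (lift ` K)" by (auto simp: Basis_vec_def)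
    then show ?thesis by (metis span_Basis span_minimal subspace_span top.extremum_uniqueI)
  qed
  ultimately obtain v :: "'d option \<Rightarrow> _" where v: "\<forall>i. v i \<in> lift ` K"
    and rep: "\<forall>p\<in>lift ` K. \<exists>\<alpha>. p = (\<Sum>i\<in>UNIV. \<alpha> i *\<^sub>R v i) \<and> (\<forall>i. \<bar>\<alpha> i\<bar> \<le> 1)"
    by (rule Auerbach_basis) (rule that)
  define x where "x i = drop (v i)" for i
  have x: "x i \<in> K" for i using spec[OF v, of i] by (auto simp: x_def)
  have vN: "v i $ None = 1" for i using spec[OF v, of i] by (auto simp: lift_def)
  have card: "real (CARD('d option)) = ?d + 1" by simp
  define c where "c = (\<Sum>i\<in>UNIV. (1 / (?d + 1)) *\<^sub>R x i)"
  have "c \<in> K"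
    unfolding c_def using x card by (intro convex_sum[OF _ assms(2)]) auto
  moreover have "c - (1 / ?d) *\<^sub>R (k - c) \<in> K" if k: "k \<in> K" for k
  proof -
    obtain \<alpha> where \<alpha>: "lift k = (\<Sum>i\<in>UNIV. \<alpha> i *\<^sub>R v i)" "\<And>i. \<bar>\<alpha> i\<bar> \<le> 1"
      using bspec[OF rep, of "lift k"] k by blast
    have "lift k $ None = (\<Sum>i\<in>UNIV. \<alpha> i)"
      unfolding \<alpha>(1) by (simp add: vN)
    \<comment> \<open>The extra coordinate says that the coefficients are barycentric.\<close>
    then have s1: "(\<Sum>i\<in>UNIV. \<alpha> i) = 1" by (simp add: lift_def)
    have "drop (lift k) = (\<Sum>i\<in>UNIV. \<alpha> i *\<^sub>R x i)"
      unfolding \<alpha>(1) by (simp add: x_def linear_sum[OF lin_drop] linear_cmul[OF lin_drop])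
    then have k_eq: "k = (\<Sum>i\<in>UNIV. \<alpha> i *\<^sub>R x i)" by simp
    have "c - (1 / ?d) *\<^sub>R (k - c) = (1 + 1 / ?d) *\<^sub>R c - (1 / ?d) *\<^sub>R k"
      by (simp add: algebra_simps)
    also have "\<dots> = (\<Sum>i\<in>UNIV. ((1 - \<alpha> i) / ?d) *\<^sub>R x i)"
    proof -
      have "(1 + 1 / ?d) * (1 / (?d + 1)) = 1 / ?d"
        by (simp add: field_simps)
      then show ?thesis
        unfolding k_eq c_def
        by (simp add: scaleR_sum_right sum_subtractf diff_divide_distrib scaleR_left_diff_distrib)
    qed
    also have "\<dots> \<in> K"
    proof (rule convex_sum[OF _ assms(2)])
      show "(\<Sum>i\<in>UNIV. (1 - \<alpha> i) / ?d) = 1"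
        using s1 card by (simp add: sum_divide_distrib[symmetric] sum_subtractf)
      show "0 \<le> (1 - \<alpha> i) / ?d" for i using \<alpha>(2)[of i] by simp
    qed (use x in auto)
    finally show ?thesis .
  qed
  ultimately show thesis by (rule that)
qed

section \<open>Convex hulls of finitely many points\<close>

text \<open>
  A bounded polar set puts \<open>0\<close> into the hull, which the bipolar theorem needs: if a hyperplane separates \<open>u\<close> from the hull and has \<open>0\<close> on the side of
  \<open>u\<close> or on it, then its normal spans a ray inside the polar set.
\<close>

lemma bipolar_finite:
  fixes P :: "(real ^ 'd) set"
  assumes "finite P"
    and bdd: "\<And>z. \<forall>p\<in>P. p \<bullet> z \<le> 1 \<Longrightarrow> norm z \<le> C"
    and u: "\<And>z. \<forall>p\<in>P. p \<bullet> z \<le> 1 \<Longrightarrow> u \<bullet> z \<le> 1"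
  shows "u \<in> convex hull P"
proof (rule ccontr)
  assume "u \<notin> convex hull P"
  then obtain a b where ab: "a \<bullet> u < b" "\<And>x. x \<in> convex hull P \<Longrightarrow> b < a \<bullet> x"
    using separating_hyperplane_closed_point[OF convex_convex_hull, of P u]
      compact_imp_closed[OF finite_imp_compact_convex_hull[OF assms(1)]] by blast
  have abP: "b < p \<bullet> a" if "p \<in> P" for p
    using ab(2)[OF hull_inc[OF that]] by (simp add: inner_commute)
  show False
  proof (cases "b < 0")
    case True
    have "u \<bullet> ((1 / b) *\<^sub>R a) \<le> 1"
      using abP True by (intro u) (auto simp: divide_simps intro: less_imp_le)
    then show False using ab(1) True by (simp add: inner_commute divide_simps)
  next
    case False
    then have nonneg: "p \<bullet> a \<ge> 0" if "p \<in> P" for p using abP[OF that] by simp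
    \<comment> \<open>For empty \<open>P\<close> the separating functional may vanish, but any ray will do.\<close>
    have "\<exists>a'. a' \<noteq> 0 \<and> (\<forall>p\<in>P. p \<bullet> a' \<ge> 0)"
    proof (cases "P = {}")
      case True
      then show ?thesis by (auto intro: exI[of _ "axis undefined 1"] simp: axis_eq_0_iff)
    next
      case False
      then obtain p where "p \<in> P" by blast
      then have "a \<noteq> 0" using abP[of p] \<open>\<not> b < 0\<close> by auto
      then show ?thesis using nonneg by blast
    qed
    then obtain a' where a': "a' \<noteq> 0" "\<And>p. p \<in> P \<Longrightarrow> p \<bullet> a' \<ge> 0" by blast
    let ?t = "(\<bar>C\<bar> + 1) / norm a'"
    have "?t \<ge> 0" by simp
    have "p \<bullet> ((- ?t) *\<^sub>R a') \<le> 1" if "p \<in> P" for p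
      using mult_nonneg_nonneg[OF \<open>?t \<ge> 0\<close> a'(2)[OF that]] by simp
    then have "norm ((- ?t) *\<^sub>R a') \<le> C" by (intro bdd) blast
    then show False using a'(1) by simp
  qed
qed

text \<open>
  Allowing the coefficients to sum to less than \<open>1\<close> saves one point compared with
  Caratheodory's theorem: \<open>d + 1\<close> points are linearly dependent, and a dependence with
  nonnegative coefficient sum can be subtracted until one coefficient vanishes, which never
  increases the total weight. For a bound of the form \<open>w \<bullet> z \<le> 1\<close>, subconvex combinations are as
  good as convex ones.
\<close>

lemma caratheodory_subconvex:
  fixes P :: "(real ^ 'd) set"
  assumes "w \<in> convex hull P"
  obtains T \<mu> where "T \<subseteq> P" "finite T" "card T \<le> CARD('d)"
    "\<And>t. t \<in> T \<Longrightarrow> 0 \<le> \<mu> t" "sum \<mu> T \<le> 1" "w = (\<Sum>t\<in>T. \<mu> t *\<^sub>R t)"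
proof -
  obtain S where S: "finite S" "S \<subseteq> P" "card S \<le> DIM(real ^ 'd) + 1" "w \<in> convex hull S"
    using assms unfolding caratheodory[of P] by blast
  then obtain l where l: "\<And>t. t \<in> S \<Longrightarrow> 0 \<le> l t" "sum l S = 1" "w = (\<Sum>t\<in>S. l t *\<^sub>R t)"
    unfolding convex_hull_finite[OF S(1)] by auto
  show thesis
  proof (cases "card S \<le> CARD('d)")
    case True
    then show thesis using that[of S l] S l by simp
  next
    case False
    then have "card S > DIM(real ^ 'd)" by simp
    then have "dependent S" using S(1) by (intro dependent_biggerset) simp
    then obtain m0 where m0: "(\<Sum>t\<in>S. m0 t *\<^sub>R t) = 0" "\<exists>t\<in>S. m0 t \<noteq> 0"
      using dependent_finite[OF S(1)] by auto
    have "\<exists>m. (\<Sum>t\<in>S. m t *\<^sub>R t) = 0 \<and> sum m S \<ge> 0 \<and> (\<exists>t\<in>S. m t > 0)"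
    proof -
      have *: "\<exists>t\<in>S. m t > 0" if "sum m S \<ge> 0" "\<exists>t\<in>S. m t \<noteq> 0" for m :: "real ^ 'd \<Rightarrow> real"
      proof (rule ccontr)
        assume "\<not> ?thesis"
        then have "\<And>t. t \<in> S \<Longrightarrow> 0 \<le> - m t" by force
        moreover from this have "sum (\<lambda>t. - m t) S = 0"
          using that(1) sum_nonneg[of S "\<lambda>t. - m t"] by (simp add: sum_negf)
        ultimately have "\<forall>t\<in>S. - m t = 0" using sum_nonneg_eq_0_iff[OF S(1), of "\<lambda>t. - m t"] by blast
        then show False using that(2) by auto
      qed
      show ?thesis
      proof (cases "sum m0 S \<ge> 0")
        case True
        then show ?thesis using m0 *[of m0] by blast
      next
        case False
        then show ?thesis using m0 *[of "\<lambda>t. - m0 t"]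
          by (intro exI[of _ "\<lambda>t. - m0 t"]) (auto simp: sum_negf)
      qed
    qed
    then obtain m where m: "(\<Sum>t\<in>S. m t *\<^sub>R t) = 0" "sum m S \<ge> 0" "\<exists>t\<in>S. m t > 0" by blast
    \<comment> \<open>The largest multiple of \<open>m\<close> that keeps all coefficients nonnegative kills the one at \<open>s\<close>.\<close>
    define S' where "S' = {t \<in> S. m t > 0}"
    have "finite S'" "S' \<noteq> {}" using S(1) m(3) by (auto simp: S'_def)
    then obtain s where s: "s \<in> S'" "\<And>t. t \<in> S' \<Longrightarrow> l s / m s \<le> l t / m t"
      using arg_min_if_finite[of S' "\<lambda>t. l t / m t"] by (metis linorder_not_le)
    define \<epsilon> where "\<epsilon> = l s / m s"
    have sS: "s \<in> S" "m s > 0" using s(1) by (auto simp: S'_def)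
    have \<epsilon>: "\<epsilon> \<ge> 0" using l(1)[OF sS(1)] sS(2) by (simp add: \<epsilon>_def)
    define \<mu> where "\<mu> t = l t - \<epsilon> * m t" for t
    have \<mu>s: "\<mu> s = 0" using sS by (simp add: \<mu>_def \<epsilon>_def)
    have \<mu>: "\<mu> t \<ge> 0" if "t \<in> S" for t
    proof (cases "m t > 0")
      case True
      then have "\<epsilon> \<le> l t / m t" using s(2)[of t] that by (simp add: S'_def \<epsilon>_def)
      then show ?thesis using True by (simp add: \<mu>_def field_simps)
    next
      case False
      then have "\<epsilon> * m t \<le> 0" using \<epsilon> by (simp add: mult_nonneg_nonpos)
      then show ?thesis using l(1)[OF that] by (simp add: \<mu>_def)
    qed
    have "sum \<mu> S \<le> 1"
      using l(2) mult_nonneg_nonneg[OF \<epsilon> m(2)]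
      by (simp add: \<mu>_def sum_subtractf sum_distrib_left[symmetric])
    then have "sum \<mu> (S - {s}) \<le> 1" using S(1) sS(1) \<mu>s by (simp add: sum_diff1)
    moreover have "w = (\<Sum>t\<in>S. \<mu> t *\<^sub>R t)"
      using l(3) m(1) by (simp add: \<mu>_def scaleR_left_diff_distrib sum_subtractf
          scaleR_scaleR[symmetric] scaleR_sum_right[symmetric] del: scaleR_scaleR)
    then have "w = (\<Sum>t\<in>S - {s}. \<mu> t *\<^sub>R t)" using S(1) sS(1) \<mu>s by (simp add: sum_diff1)
    moreover have "card (S - {s}) \<le> CARD('d)" using S(3) sS(1) S(1) by simp
    ultimately show thesis using that[of "S - {s}" \<mu>] S(1,2) \<mu> by auto
  qed
qed

text \<open>
  The hull of a finite \<open>(1 - r)\<close>-net of the unit ball contains the ball of radius \<open>r\<close>, since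
  no half-space can miss the net and meet the small ball: the net has a point close to the
  inner normal of length \<open>1\<close>. Each point of the net is in the hull of finitely many points
  of \<open>Q\<close>.
\<close>

lemma finite_subset_hull_contains_shrunk_ball:
  fixes Q :: "(real ^ 'd) set"
  assumes "cball 0 1 \<subseteq> convex hull Q" and "0 < r" "r < 1"
  obtains F where "finite F" "F \<subseteq> Q" "cball 0 r \<subseteq> convex hull F"
proof -
  obtain N where N: "N \<subseteq> cball 0 1" "finite N" "cball 0 1 \<subseteq> (\<Union>x\<in>N. ball (x :: real ^ 'd) (1 - r))"
    using compactE_image[OF compact_cball, of "cball 0 1" "\<lambda>x. ball x (1 - r)" "0 :: real ^ 'd" 1]
      assms(3) by force
  have "\<exists>F. finite F \<and> F \<subseteq> Q \<and> n \<in> convex hull F" if "n \<in> N" for n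
  proof -
    have "n \<in> convex hull Q" using that N(1) assms(1) by blast
    then show ?thesis unfolding caratheodory[of Q] by blast
  qed
  then obtain f where f: "\<And>n. n \<in> N \<Longrightarrow> finite (f n) \<and> f n \<subseteq> Q \<and> n \<in> convex hull (f n)" by metis
  define F where "F = (\<Union>n\<in>N. f n)"
  have F: "finite F" "F \<subseteq> Q" using f N(2) by (auto simp: F_def)
  have NF: "N \<subseteq> convex hull F"
  proof
    fix n assume "n \<in> N"
    then have "f n \<subseteq> F" by (auto simp: F_def)
    then show "n \<in> convex hull F" using f[OF \<open>n \<in> N\<close>] hull_mono by blast
  qed
  have "u \<in> convex hull F" if u: "u \<in> cball 0 r" for u
  proof (rule ccontr)
    assume "u \<notin> convex hull F"
    then obtain a b where ab: "a \<bullet> u < b" "\<And>x. x \<in> convex hull F \<Longrightarrow> b < a \<bullet> x"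
      using separating_hyperplane_closed_point[OF convex_convex_hull, of F u]
        compact_imp_closed[OF finite_imp_compact_convex_hull[OF F(1)]] by blast
    have "(0 :: real ^ 'd) \<in> cball 0 1" by simp
    then obtain n0 where "n0 \<in> N" using N(3) by blast
    have "a \<noteq> 0" using ab(1) ab(2)[of n0] NF \<open>n0 \<in> N\<close> by auto
    \<comment> \<open>the unit vector at which \<open>a\<close> is smallest on the unit ball\<close>
    define e where "e = (- 1 / norm a) *\<^sub>R a"
    have "norm e = 1" using \<open>a \<noteq> 0\<close> by (simp add: e_def)
    then obtain n where n: "n \<in> N" "dist n e < 1 - r" using N(3) by (force simp: subset_iff)
    have "a \<bullet> n = a \<bullet> e + a \<bullet> (n - e)" by (simp add: inner_diff_right)
    also have "a \<bullet> e = - norm a"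
      using \<open>a \<noteq> 0\<close> by (simp add: e_def power2_norm_eq_inner[symmetric] power2_eq_square)
    also have "a \<bullet> (n - e) \<le> norm a * (1 - r)"
      using n(2) by (intro order_trans[OF norm_cauchy_schwarz] mult_left_mono) (auto simp: dist_norm)
    finally have "a \<bullet> n \<le> - (norm a * r)" by (simp add: algebra_simps)
    moreover have "- (a \<bullet> u) \<le> norm a * r"
      using u norm_cauchy_schwarz[of "- a" u] mult_left_mono[of "norm u" r "norm a"] by auto
    moreover have "b < a \<bullet> n" using ab(2) NF n(1) by blast
    ultimately show False using ab(1) by linarith
  qed
  then show thesis using that F by blast
qed

section \<open>Selecting twice as many points as the dimension\<close>

text \<open>
  The selected points are an Auerbach basis \<open>v\<close> of \<open>P\<close> and the at most \<open>d\<close> points that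
  represent \<open>w\<close>, a multiple of \<open>- (\<Sum>i. v i)\<close>. The asymmetry bound \<open>\<kappa>\<close> of the polar set
  determines how large a multiple stays in the hull of \<open>P\<close>, and thereby how far below zero
  the sum of the \<open>v i \<bullet> z\<close> can be.
\<close>

lemma few_points_control_polar:
  fixes P :: "(real ^ 'd) set"
  assumes "finite P" and "span P = UNIV" and "\<kappa> > 0"
    and bdd: "\<And>z. \<forall>p\<in>P. p \<bullet> z \<le> 1 \<Longrightarrow> norm z \<le> C"
    and asym: "\<And>z. \<forall>p\<in>P. p \<bullet> z \<le> 1 \<Longrightarrow> \<forall>p\<in>P. - (p \<bullet> z) \<le> \<kappa>"
  obtains V where "V \<subseteq> P" "card V \<le> 2 * CARD('d)"
    "\<forall>z. (\<forall>p\<in>V. p \<bullet> z \<le> 1) \<longrightarrow> (\<forall>p\<in>P. p \<bullet> z \<le> (\<kappa> + 2) * CARD('d))"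
proof -
  let ?d = "real CARD('d)"
  obtain v :: "'d \<Rightarrow> _" where v: "\<forall>i. v i \<in> P"
    and rep: "\<forall>p\<in>P. \<exists>\<alpha>. p = (\<Sum>i\<in>UNIV. \<alpha> i *\<^sub>R v i) \<and> (\<forall>i. \<bar>\<alpha> i\<bar> \<le> 1)"
    by (rule Auerbach_basis[OF finite_imp_compact[OF assms(1)] assms(2)]) (rule that)
  define w where "w = - (1 / (\<kappa> * ?d)) *\<^sub>R (\<Sum>i\<in>UNIV. v i)"
  have w_inner: "w \<bullet> z = (\<Sum>i\<in>UNIV. - (v i \<bullet> z)) / (\<kappa> * ?d)" for z
    by (simp add: w_def inner_sum_left sum_negf)
  have "w \<in> convex hull P"
  proof (rule bipolar_finite[OF assms(1) bdd])
    fix z assume z: "\<forall>p\<in>P. p \<bullet> z \<le> 1"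
    have "(\<Sum>i\<in>UNIV. - (v i \<bullet> z)) \<le> (\<Sum>i\<in>(UNIV :: 'd set). \<kappa>)"
      using asym[OF z] v by (intro sum_mono) auto
    then show "w \<bullet> z \<le> 1"
      using assms(3) by (simp add: w_inner field_simps)
  qed
  then obtain T \<mu> where T: "T \<subseteq> P" "finite T" "card T \<le> CARD('d)"
    and \<mu>: "\<And>t. t \<in> T \<Longrightarrow> 0 \<le> \<mu> t" "sum \<mu> T \<le> 1" "w = (\<Sum>t\<in>T. \<mu> t *\<^sub>R t)"
    by (rule caratheodory_subconvex) blast
  show thesis
  proof (rule that[of "range v \<union> T"])
    show "range v \<union> T \<subseteq> P" using v T by auto
    have "card (range v \<union> T) \<le> card (range v) + card T" by (rule card_Un_le)
    also have "card (range v) \<le> CARD('d)" by (rule card_image_le) simp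
    finally show "card (range v \<union> T) \<le> 2 * CARD('d)" using T(3) by simp
    show "\<forall>z. (\<forall>p\<in>range v \<union> T. p \<bullet> z \<le> 1) \<longrightarrow> (\<forall>p\<in>P. p \<bullet> z \<le> (\<kappa> + 2) * ?d)"
    proof (intro allI impI ballI)
      fix z p assume z: "\<forall>p\<in>range v \<union> T. p \<bullet> z \<le> 1" and "p \<in> P"
      have "w \<bullet> z = (\<Sum>t\<in>T. \<mu> t * (t \<bullet> z))" by (simp add: \<mu>(3) inner_sum_left)
      also have "\<dots> \<le> (\<Sum>t\<in>T. \<mu> t * 1)"
        using z \<mu>(1) by (intro sum_mono mult_left_mono) auto
      also have "\<dots> \<le> 1" using \<mu>(2) by simp
      finally have sum: "(\<Sum>i\<in>UNIV. - (v i \<bullet> z)) \<le> \<kappa> * ?d"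
        using assms(3) by (simp add: w_inner field_simps)
      obtain \<alpha> where \<alpha>: "p = (\<Sum>i\<in>UNIV. \<alpha> i *\<^sub>R v i)" "\<And>i. \<bar>\<alpha> i\<bar> \<le> 1"
        using bspec[OF rep \<open>p \<in> P\<close>] by blast
      have "p \<bullet> z = (\<Sum>i\<in>UNIV. \<alpha> i * (v i \<bullet> z))" by (simp add: \<alpha>(1) inner_sum_left)
      also have "\<dots> \<le> (\<Sum>i\<in>UNIV. 2 - v i \<bullet> z)"
      proof (rule sum_mono)
        fix i
        have "\<alpha> i * (v i \<bullet> z) \<le> \<bar>\<alpha> i\<bar> * \<bar>v i \<bullet> z\<bar>" by (metis abs_ge_self abs_mult)
        also have "\<dots> \<le> \<bar>v i \<bullet> z\<bar>" using \<alpha>(2)[of i] by (simp add: mult_left_le_one_le)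
        \<comment> \<open>\<open>\<bar>t\<bar> \<le> 2 - t\<close> for \<open>t \<le> 1\<close> turns the bound on the sum into one on the absolute values.\<close>
        also have "\<dots> \<le> 2 - v i \<bullet> z" using bspec[OF z, of "v i"] by simp
        finally show "\<alpha> i * (v i \<bullet> z) \<le> 2 - v i \<bullet> z" .
      qed
      also have "\<dots> = 2 * ?d + (\<Sum>i\<in>UNIV. - (v i \<bullet> z))" by (simp add: sum_subtractf sum_negf)
      finally show "p \<bullet> z \<le> (\<kappa> + 2) * ?d" using sum by (simp add: algebra_simps)
    qed
  qed
qed

section \<open>The quantitative Steinitz theorem\<close>

theorem theorem1:
  fixes Q :: "(real ^ 'd) set"
  assumes "cball 0 1 \<subseteq> convex hull Q"
  shows "\<exists>P. P \<subseteq> Q \<and> finite P \<and> card P \<le> 2 * CARD('d) \<and>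
    (\<lambda>x. (1 / (6 * (real CARD('d))\<^sup>2)) *\<^sub>R x) ` cball 0 1 \<subseteq> convex hull P"
proof -
  let ?d = "real CARD('d)"
  have d: "?d \<ge> 1" by (simp add: Suc_le_eq)
  obtain F where F: "finite F" "F \<subseteq> Q" "cball 0 (5/6) \<subseteq> convex hull F"
    using finite_subset_hull_contains_shrunk_ball[OF assms, of "5/6"] by auto
  define K where "K = {x. \<forall>q\<in>F. q \<bullet> x \<le> 1}"
  have K_Inter: "K = (\<Inter>q\<in>F. {x. q \<bullet> x \<le> 1})" by (auto simp: K_def)
  have K_bound: "norm x \<le> 6/5" if x: "x \<in> K" for x
  proof (cases "x = 0")
    case False
    have "convex hull F \<subseteq> {q. x \<bullet> q \<le> 1}"
      using x by (intro hull_minimal convex_halfspace_le) (auto simp: K_def inner_commute)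
    moreover have "(5 / 6 / norm x) *\<^sub>R x \<in> cball 0 (5/6)" using False by simp
    ultimately have "x \<bullet> ((5 / 6 / norm x) *\<^sub>R x) \<le> 1" using F(3) by blast
    then show ?thesis
      using False by (simp add: power2_norm_eq_inner[symmetric] power2_eq_square)
  qed simp
  have "compact K"
  proof -
    have "closed K" unfolding K_Inter by (intro closed_INT ballI closed_halfspace_le)
    moreover have "bounded K" unfolding bounded_iff using K_bound by blast
    ultimately show ?thesis by (simp add: compact_eq_bounded_closed)
  qed
  have "convex K" unfolding K_Inter by (intro convex_INT convex_halfspace_le)
  obtain C where C: "C > 0" "\<And>q. q \<in> F \<Longrightarrow> norm q \<le> C"
    using finite_imp_bounded[OF F(1)] by (auto simp: bounded_pos)
  have "cball 0 (1 / C) \<subseteq> K"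
  proof
    fix x :: "real ^ 'd" assume x: "x \<in> cball 0 (1 / C)"
    have "q \<bullet> x \<le> 1" if "q \<in> F" for q
    proof -
      have "q \<bullet> x \<le> norm q * norm x" by (rule norm_cauchy_schwarz)
      also have "\<dots> \<le> C * (1 / C)" using C x that by (intro mult_mono) auto
      finally show ?thesis using C(1) by simp
    qed
    then show "x \<in> K" by (simp add: K_def)
  qed
  then obtain c where c: "c \<in> K" "\<And>k. k \<in> K \<Longrightarrow> c - (1 / ?d) *\<^sub>R (k - c) \<in> K"
    using convex_low_asymmetry_centre[OF \<open>compact K\<close> \<open>convex K\<close>, of "1 / C"] C(1) by auto
  \<comment> \<open>The origin is in \<open>K\<close>, so by the choice of \<open>c\<close> also \<open>(1 + 1/d) c\<close> is: \<open>c\<close> is interior.\<close>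
  have slack: "q \<bullet> c < 1" if "q \<in> F" for q
  proof -
    have "0 \<in> K" by (simp add: K_def)
    from c(2)[OF this] have "q \<bullet> (c + (1 / ?d) *\<^sub>R c) \<le> 1" using that by (simp add: K_def)
    then have "(1 + 1 / ?d) * (q \<bullet> c) \<le> 1" by (simp add: algebra_simps)
    then have "(?d + 1) * (q \<bullet> c) \<le> ?d" using d by (simp add: field_simps)
    then have "q \<bullet> c \<le> ?d / (?d + 1)" using d by (simp add: field_simps)
    also have "\<dots> < 1" using d by simp
    finally show ?thesis .
  qed
  \<comment> \<open>The half-space \<open>q \<bullet> x \<le> 1\<close> is \<open>p q \<bullet> (x - c) \<le> 1\<close> when seen from \<open>c\<close>.\<close>
  define p where "p q = (1 / (1 - q \<bullet> c)) *\<^sub>R q" for q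
  have p_le_1: "p q \<bullet> z \<le> 1 \<longleftrightarrow> q \<bullet> (c + z) \<le> 1" if "q \<in> F" for q z
    using slack[OF that] by (simp add: p_def inner_add_right divide_simps) linarith
  have polar: "(\<forall>x\<in>p ` F. x \<bullet> z \<le> 1) \<longleftrightarrow> c + z \<in> K" for z
    using p_le_1 by (auto simp: K_def)
  have span_p: "span (p ` F) = UNIV"
  proof -
    have "F \<subseteq> span (p ` F)"
    proof
      fix q assume q: "q \<in> F"
      then have "q = (1 - q \<bullet> c) *\<^sub>R p q" using slack[OF q] by (simp add: p_def)
      then show "q \<in> span (p ` F)" using q by (metis imageI span_base span_scale)
    qed
    then have "convex hull F \<subseteq> span (p ` F)"
      by (simp add: hull_minimal subspace_imp_convex)
    with F(3) have ball: "cball 0 (5/6) \<subseteq> span (p ` F)" by (rule order_trans)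
    have "Basis \<subseteq> span (p ` F)"
    proof
      fix b :: "real ^ 'd" assume "b \<in> Basis"
      then have "(5/6) *\<^sub>R b \<in> span (p ` F)" using ball by auto
      then have "(6/5) *\<^sub>R (5/6) *\<^sub>R b \<in> span (p ` F)" by (rule span_scale)
      then show "b \<in> span (p ` F)" by simp
    qed
    then show ?thesis by (metis span_Basis span_minimal subspace_span top.extremum_uniqueI)
  qed
  have polar_bound: "norm z \<le> 12/5" if "\<forall>x\<in>p ` F. x \<bullet> z \<le> 1" for z
  proof -
    have "c + z \<in> K" using that polar by blast
    then show ?thesis
      using K_bound[of "c + z"] K_bound[OF c(1)] norm_triangle_ineq4[of "c + z" c] by simp
  qed
  have asym: "\<forall>x\<in>p ` F. - (x \<bullet> z) \<le> ?d" if z: "\<forall>x\<in>p ` F. x \<bullet> z \<le> 1" for z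
  proof
    fix x assume x: "x \<in> p ` F"
    have "c + z \<in> K" using z polar by blast
    then have "c + (- (1 / ?d) *\<^sub>R z) \<in> K" using c(2)[of "c + z"] by simp
    then have "x \<bullet> (- (1 / ?d) *\<^sub>R z) \<le> 1" using polar x by blast
    then show "- (x \<bullet> z) \<le> ?d" using d by (simp add: field_simps)
  qed
  have "\<exists>V \<subseteq> p ` F. card V \<le> 2 * CARD('d) \<and>
    (\<forall>z. (\<forall>x\<in>V. x \<bullet> z \<le> 1) \<longrightarrow> (\<forall>x\<in>p ` F. x \<bullet> z \<le> (?d + 2) * ?d))"
  proof (rule few_points_control_polar[where P = "p ` F" and \<kappa> = ?d and C = "12/5"])
    show "finite (p ` F)" using F(1) by simp
    show "?d > 0" using d by simp
  qed (fact span_p polar_bound asym | intro exI conjI; assumption)+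
  then obtain V where V: "V \<subseteq> p ` F" "card V \<le> 2 * CARD('d)"
    and V_bound: "\<forall>z. (\<forall>x\<in>V. x \<bullet> z \<le> 1) \<longrightarrow> (\<forall>x\<in>p ` F. x \<bullet> z \<le> (?d + 2) * ?d)"
    by blast
  obtain G where G: "G \<subseteq> F" "inj_on p G" "V = p ` G"
    using V(1) by (auto simp: subset_image_inj)
  have "card G \<le> 2 * CARD('d)" using V(2) G(2,3) by (simp add: card_image)
  have "finite G" using G(1) F(1) by (rule finite_subset)
  have G_bound: "norm x \<le> 6 * ?d\<^sup>2" if x: "\<forall>q\<in>G. q \<bullet> x \<le> 1" for x
  proof -
    define M where "M = (?d + 2) * ?d"
    have M: "M \<ge> 1" using mult_mono[of 1 "?d + 2" 1 ?d] d by (simp add: M_def)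
    define z where "z = x - c"
    have "y \<bullet> z \<le> 1" if "y \<in> V" for y
      using that x p_le_1[of _ z] G(1) unfolding G(3) by (auto simp: z_def)
    then have "y \<bullet> z \<le> M" if "y \<in> p ` F" for y using V_bound that unfolding M_def by blast
    then have "y \<bullet> ((1 / M) *\<^sub>R z) \<le> 1" if "y \<in> p ` F" for y using that M by simp
    then have k: "c + (1 / M) *\<^sub>R z \<in> K" using polar by blast
    \<comment> \<open>Here \<open>x\<close> is written as the image of a point of \<open>K\<close> under dilation by \<open>M\<close> about \<open>c\<close>.\<close>
    have "x = M *\<^sub>R (c + (1 / M) *\<^sub>R z) - (M - 1) *\<^sub>R c"
      using M by (simp add: z_def algebra_simps)
    then have "norm x \<le> norm (M *\<^sub>R (c + (1 / M) *\<^sub>R z)) + norm ((M - 1) *\<^sub>R c)"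
      by (metis norm_triangle_ineq4)
    also have "\<dots> = M * norm (c + (1 / M) *\<^sub>R z) + (M - 1) * norm c" using M by simp
    also have "\<dots> \<le> M * (6/5) + (M - 1) * (6/5)"
      using M K_bound[OF k] K_bound[OF c(1)] by (intro add_mono mult_left_mono) auto
    also have "\<dots> \<le> 6 * ?d\<^sup>2"
    proof -
      \<comment> \<open>Multiplied by \<open>5/6\<close>, the claim is \<open>2 M - 1 \<le> 5 d\<^sup>2\<close>, which is this product.\<close>
      have "0 \<le> (3 * ?d - 1) * (?d - 1)" using d by (intro mult_nonneg_nonneg) linarith+
      then show ?thesis by (simp add: M_def algebra_simps power2_eq_square)
    qed
    finally show ?thesis .
  qed
  have "(1 / (6 * ?d\<^sup>2)) *\<^sub>R u \<in> convex hull G" if u: "u \<in> cball 0 1" for u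
  proof (rule bipolar_finite[OF \<open>finite G\<close> G_bound])
    fix x assume x: "\<forall>q\<in>G. q \<bullet> x \<le> 1"
    have "u \<bullet> x \<le> norm u * norm x" by (rule norm_cauchy_schwarz)
    also have "\<dots> \<le> 1 * (6 * ?d\<^sup>2)" using u G_bound[OF x] by (intro mult_mono) auto
    finally show "((1 / (6 * ?d\<^sup>2)) *\<^sub>R u) \<bullet> x \<le> 1" using d by (simp add: field_simps)
  qed
  then show ?thesis
    using G(1) F(2) \<open>finite G\<close> \<open>card G \<le> 2 * CARD('d)\<close> by (intro exI[of _ G]) auto
qed

end
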